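(* Let $n\ge 3$, let $\mathcal F_n\subset\mathcal P_n$ be closed with respect to similarities and relabellings, let $\mathcal L$ be the set of lines in $\mathbb R^2$, and let $\Psi:\mathcal F_n\to\mathcal L$. Consider the following statements: (a) $\Psi$ is a Kimberling central line. (b) $\Psi$ is a central line. (c) For $1\le i\le n-2$, $1\le j\le n$ there exist functions $a_{ij}:\mathcal F_n\to\mathbb R$ such that, writing for $P\in\mathcal F_n$ $$A(P)=\begin{bmatrix}1&\ldots&1\\ a_{11}(P)&\ldots&a_{1n}(P)\\ \vdots&&\vdots\\ a_{n-2,1}(P)&\ldots&a_{n-2,n}(P)\end{bmatrix},\qquad b=\begin{bmatrix}1\\0\\ \vdots\\0\end{bmatrix}\in\mathbb R^{n-1},$$ for each $P=(V_1,\ldots,V_n)\in\mathcal F_n$ the following hold: - the linear system $A(P)x=b$ is compatible and the matrix $A(P)$ has rank $n-1$; - the points in $\Psi(P)$ are exactly those of the type $X=x_1V_1+\ldots+x_nV_n$ with $x=(x_1,\ldots,x_n)^{T}$ a solution of $A(P)x=b$; - for every $\alpha\in D_n$, if $A(P)(x_1,\ldots,x_n)^{T}=b$ then $A(\alpha(P))(x_{\alpha(1)},\ldots,x_{\alpha(n)})^{T}=b$, where $\alpha(P)=(V_{\alpha(1)},\ldots,V_{\alpha(n)})$; - for every plane similarity $T$, if $A(P)(x_1,\ldots,x_n)^{T}=b$ then $A(T(P))(x_1,\ldots,x_n)^{T}=b$, where $T(P)=(T(V_1),\ldots,T(V_n))$. Then statements (b) and (c) are equivalent, and statement (a) implies both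 of them.
   Context: For $n\ge 3$, $\mathcal P_n$ is the set of all $n$-gons with labelled vertices in the plane, i.e. all $n$-tuples $(V_1,\ldots,V_n)$ of points of $\mathbb R^2$. Let $\rho,\sigma$ be the permutations of $\{1,\ldots,n\}$ given by $\rho(i)=i+1 \bmod n$ and $\sigma(i)=n+2-i \bmod n$ (values in $\{1,\dots,n\}$), and let $D_n$ be the dihedral group of order $2n$ they generate. Two $n$-gons $(V_i)$, $(V_i')$ differ only in their labelling if there is $\alpha\in D_n$ with $V_i'=V_{\alpha(i)}$ for all $i$. Two $n$-gons are similar via a plane similarity $T$ (orientation-preserving or reversing) if $T(V_i)=V_i'$ for all $i$. A subset $\mathcal F_n\subset\mathcal P_n$ is closed with respect to similarities and relabellings if every $n$-gon similar to, or differing only in its labelling from, an element of $\mathcal F_n$ is in $\mathcal F_n$. A center is a function $\Phi:\mathcal F_n\to\mathbb R^2$ such that (1) $\Phi(T(P))=T(\Phi(P))$ for every plane similarity $T$ and $P\in\mathcal F_n$; (2) $\Phi(P)=\Phi(Q)$ whenever $P,Q$ differ only in their labelling. A central line is a function $\Psi:\mathcal F_n\to\mathcal L$ such that (1) $\Psi(T(P))=T(\Psi(P))$ for every plane similarity $T$ and $P\in\mathcal F_n$; (2) $\Psi(P)=\Psi(Q)$ whenever $P,Q$ differ only in their labelling. A Kimberling central line is a function $\Psi:\mathcal F_n\to\mathcal L$ for which there exist two centers $\Phi,\Phi':\mathcal F_n\to\mathbb R^2$ such that, for every $P\in\mathcal F_n$, $\Phi(P)\ne\Phi'(P)$ and the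 line $\Psi(P)$ passes through $\Phi(P)$ and $\Phi'(P)$.
   Formalization: (b) ⇒ (c) is proved only when Ψ(P) contains the vertices of every P in F_n with collinear vertices; without this it is false (collinear n-gons, perpendicular to their line through the centroid), and (c) implies it. The other implications are unconditional. *)

theory Defs
  imports
    "HOL-Analysis.Analysis"
    "HOL-Algebra.Bij"
    "HOL-Algebra.Generated_Groups"
    "Jordan_Normal_Form.DL_Rank"
begin

text \<open>
  An \<open>n\<close>-gon is a list of \<open>n\<close> points of the plane, degenerate ones included. Labels are shifted
  to \<open>0, \<dots>, n - 1\<close>: the vertex with label \<open>i\<close> in the usual numbering from \<open>1\<close> is \<open>P ! (i - 1)\<close>.
\<close>

type_synonym point = "real ^ 2"

type_synonym polygon = "point list"

definition polygons :: "nat \<Rightarrow> polygon set" where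
  "polygons n = {P. length P = n}"

text \<open>
  After the shift of labels, \<open>i \<mapsto> i + 1\<close> and \<open>i \<mapsto> n + 2 - i\<close> modulo \<open>n\<close> become
  \<open>i \<mapsto> i + 1\<close> and \<open>i \<mapsto> n - i\<close> modulo \<open>n\<close>.
\<close>

definition label_shift :: "nat \<Rightarrow> nat \<Rightarrow> nat" where
  "label_shift n = (\<lambda>i\<in>{..<n}. (i + 1) mod n)"

definition label_flip :: "nat \<Rightarrow> nat \<Rightarrow> nat" where
  "label_flip n = (\<lambda>i\<in>{..<n}. (n - i) mod n)"

definition dihedral :: "nat \<Rightarrow> (nat \<Rightarrow> nat) set" where
  "dihedral n = generate (BijGroup {..<n}) {label_shift n, label_flip n}"

definition relabel :: "(nat \<Rightarrow> nat) \<Rightarrow> polygon \<Rightarrow> polygon" where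
  "relabel \<alpha> P = map (\<lambda>i. P ! \<alpha> i) [0..<length P]"

definition differ_in_labelling :: "nat \<Rightarrow> polygon \<Rightarrow> polygon \<Rightarrow> bool" where
  "differ_in_labelling n P Q \<longleftrightarrow> (\<exists>\<alpha>\<in>dihedral n. Q = relabel \<alpha> P)"

text \<open>Such maps are automatically bijective, and may preserve or reverse orientation.\<close>

definition similarity :: "(point \<Rightarrow> point) \<Rightarrow> bool" where
  "similarity T \<longleftrightarrow> (\<exists>r>0. \<forall>x y. dist (T x) (T y) = r * dist x y)"

definition closed_family :: "nat \<Rightarrow> polygon set \<Rightarrow> bool" where
  "closed_family n F \<longleftrightarrow>
     F \<subseteq> polygons n \<and>
     (\<forall>P\<in>F. \<forall>T. similarity T \<longrightarrow> map T P \<in> F) \<and>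
     (\<forall>P\<in>F. \<forall>Q. differ_in_labelling n P Q \<longrightarrow> Q \<in> F)"

definition plane_lines :: "point set set" where
  "plane_lines = {affine hull {p, q} | p q. p \<noteq> q}"

text \<open>
  Functions on a family \<open>F\<close> of polygons are total functions of which only the values on \<open>F\<close> matter.
\<close>

definition center :: "nat \<Rightarrow> polygon set \<Rightarrow> (polygon \<Rightarrow> point) \<Rightarrow> bool" where
  "center n F \<Phi> \<longleftrightarrow>
     (\<forall>P\<in>F. \<forall>T. similarity T \<longrightarrow> \<Phi> (map T P) = T (\<Phi> P)) \<and>
     (\<forall>P\<in>F. \<forall>Q\<in>F. differ_in_labelling n P Q \<longrightarrow> \<Phi> P = \<Phi> Q)"

definition central_line :: "nat \<Rightarrow> polygon set \<Rightarrow> (polygon \<Rightarrow> point set) \<Rightarrow> bool" where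
  "central_line n F \<Psi> \<longleftrightarrow>
     \<Psi> \<in> F \<rightarrow> plane_lines \<and>
     (\<forall>P\<in>F. \<forall>T. similarity T \<longrightarrow> \<Psi> (map T P) = T ` \<Psi> P) \<and>
     (\<forall>P\<in>F. \<forall>Q\<in>F. differ_in_labelling n P Q \<longrightarrow> \<Psi> P = \<Psi> Q)"

definition Kimberling_central_line ::
    "nat \<Rightarrow> polygon set \<Rightarrow> (polygon \<Rightarrow> point set) \<Rightarrow> bool" where
  "Kimberling_central_line n F \<Psi> \<longleftrightarrow>
     \<Psi> \<in> F \<rightarrow> plane_lines \<and>
     (\<exists>\<Phi> \<Phi>'. center n F \<Phi> \<and> center n F \<Phi>' \<and>
        (\<forall>P\<in>F. \<Phi> P \<noteq> \<Phi>' P \<and> \<Phi> P \<in> \<Psi> P \<and> \<Phi>' P \<in> \<Psi> P))"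

text \<open>
  The \<open>(n - 1) \<times> n\<close> matrix with first row \<open>(1, \<dots>, 1)\<close> and rows \<open>1, \<dots>, n - 2\<close> below it (counting
  from \<open>0\<close>) given by \<open>a\<close>; the second index of \<open>a\<close> runs over the labels \<open>0, \<dots>, n - 1\<close>.
\<close>

definition coeff_matrix ::
    "nat \<Rightarrow> (nat \<Rightarrow> nat \<Rightarrow> polygon \<Rightarrow> real) \<Rightarrow> polygon \<Rightarrow> real mat" where
  "coeff_matrix n a P = mat (n - 1) n (\<lambda>(i, j). if i = 0 then 1 else a i j P)"

definition solutions ::
    "nat \<Rightarrow> (nat \<Rightarrow> nat \<Rightarrow> polygon \<Rightarrow> real) \<Rightarrow> polygon \<Rightarrow> real Matrix.vec set" where
  "solutions n a P = {x \<in> carrier_vec n. coeff_matrix n a P *\<^sub>v x = unit_vec (n - 1) 0}"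

text \<open>
  The first argument of \<^const>\<open>vec_space.rank\<close> is the number of rows. The first row of the system
  says that the coordinates \<open>x\<close> sum to \<open>1\<close>, so the points of \<open>\<Psi> P\<close> all lie in the affine hull of the
  vertices. A polygon in \<open>F\<close> with collinear vertices therefore has all of them on \<open>\<Psi> P\<close>. A
  central line need not have this property: on the non-constant collinear polygons, the
  perpendicular through the centroid of the vertices is a central line.
\<close>

definition given_by_linear_systems ::
    "nat \<Rightarrow> polygon set \<Rightarrow> (polygon \<Rightarrow> point set) \<Rightarrow> bool" where
  "given_by_linear_systems n F \<Psi> \<longleftrightarrow>
     (\<exists>a. \<forall>P\<in>F.
        solutions n a P \<noteq> {} \<and> vec_space.rank (n - 1) (coeff_matrix n a P) = n - 1 \<and>
        \<Psi> P = {\<Sum>i<n. vec_index x i *\<^sub>R P ! i | x. x \<in> solutions n a P} \<and>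
        (\<forall>\<alpha>\<in>dihedral n. \<forall>x\<in>solutions n a P.
           Matrix.vec n (\<lambda>i. vec_index x (\<alpha> i)) \<in> solutions n a (relabel \<alpha> P)) \<and>
        (\<forall>T. similarity T \<longrightarrow> (\<forall>x\<in>solutions n a P. x \<in> solutions n a (map T P))))"

end

theory Submission
  imports Defs
begin

text \<open>
  A line \<open>\<Psi> P\<close> has to be turned into a one-dimensional affine family of coordinate vectors \<open>x\<close>
  in a way that depends on \<open>P\<close> and \<open>\<Psi> P\<close> only, so that it is automatically compatible with
  relabellings and similarities. A point has many coordinate vectors with respect to the vertices
  \<open>V\<^sub>i\<close>; the choice made here is to keep those of the form \<open>x\<^sub>i = g V\<^sub>i\<close> with \<open>g\<close> an affine function
  on the plane (these are the vectors of least norm). Let \<open>S\<close> be the set of all such \<open>x\<close> with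
  coordinate sum \<open>1\<close> and \<open>\<Sum>x\<^sub>i V\<^sub>i\<close> on the line. Relabelling the polygon permutes the entries of \<open>x\<close>,
  and a similarity \<open>T\<close> replaces \<open>g\<close> by \<open>g \<circ> T\<^sup>-\<^sup>1\<close> without changing \<open>x\<close>, so \<open>S\<close> is equivariant whenever \<open>\<Psi>\<close> is
  (\<open>affine_weights_relabel\<close>, \<open>affine_weights_similarity\<close>).

  With \<open>w\<^sub>i = (1, V\<^sub>i)\<close>, the sum and the point belonging to \<open>x\<^sub>i = u \<bullet> w\<^sub>i\<close> are the two components of
  \<open>M u = \<Sum>(u \<bullet> w\<^sub>i) w\<^sub>i\<close>. This operator is self-adjoint, its kernel consists of the \<open>u\<close> orthogonal to all
  \<open>w\<^sub>i\<close>, and hence its range is the span of the \<open>w\<^sub>i\<close>. So every point of the affine hull of the vertices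
  has exactly one coordinate vector of the chosen form and of sum \<open>1\<close>, and if the line lies in that hull, \<open>S\<close> is
  an affine line mapped bijectively onto it (\<open>affine_weights_line\<close>). Any affine line in the hyperplane of
  coordinate sum \<open>1\<close> is the solution set of a system of full rank whose first row is constant \<open>1\<close>
  (\<open>line_as_solution_set\<close>).

  A central line lies in the affine hull of the vertices if they are not collinear, for the hull is then the
  whole plane. If they lie on a line but do not coincide, it does so once it contains the vertices. They
  cannot all coincide, since a quarter turn about the common vertex would fix the polygon but not the line
  through it. For a Kimberling central line, a collinear polygon is fixed by the reflection
  in a line carrying its vertices; so both centers are fixed too, and the line through them is that
  carrier.
\<close>

(* The infix is left to the inner product of Euclidean spaces. *)
no_notation Matrix.scalar_prod (infix \<open>\<bullet>\<close> 70)

section \<open>Plane similarities and lines\<close>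

lemma similarityE:
  assumes "similarity T"
  obtains b r f where "r > 0" "orthogonal_transformation f" "\<And>x. T x = b + r *\<^sub>R f x"
proof -
  obtain r where r: "r > 0" "\<And>x y. dist (T x) (T y) = r * dist x y"
    using assms unfolding similarity_def by blast
  define f where "f = (\<lambda>x. (1 / r) *\<^sub>R (T x - T 0))"
  have "dist (f x) (f y) = dist x y" for x y
  proof -
    have "f x - f y = (1 / r) *\<^sub>R (T x - T y)"
      by (simp add: f_def algebra_simps)
    then have "dist (f x) (f y) = (1 / r) * dist (T x) (T y)"
      using r(1) by (simp add: dist_norm)
    then show ?thesis
      using r by simp
  qed
  then have "orthogonal_transformation f"
    unfolding orthogonal_transformation_isometry by (simp add: f_def)
  moreover have "T x = T 0 + r *\<^sub>R f x" for x
    using r(1) by (simp add: f_def)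
  ultimately show thesis
    using that r(1) by blast
qed

lemma similarity_inj:
  assumes "similarity T"
  shows "inj T"
proof (rule injI)
  fix x y assume "T x = T y"
  moreover obtain r where "r > 0" "dist (T x) (T y) = r * dist x y"
    using assms unfolding similarity_def by blast
  ultimately show "x = y"
    by simp
qed

lemma similarity_sum:
  fixes V :: "'i \<Rightarrow> point"
  assumes "similarity T" "sum c I = 1"
  shows "T (\<Sum>i\<in>I. c i *\<^sub>R V i) = (\<Sum>i\<in>I. c i *\<^sub>R T (V i))"
proof -
  obtain b r f where "r > 0" and f: "orthogonal_transformation f" "\<And>x. T x = b + r *\<^sub>R f x"
    using similarityE[OF assms(1)] by metis
  have "linear f"
    by (rule orthogonal_transformation_linear[OF f(1)])
  then have lin: "f (\<Sum>i\<in>I. c i *\<^sub>R V i) = (\<Sum>i\<in>I. c i *\<^sub>R f (V i))"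
    by (simp add: linear_sum linear_cmul)
  have "(\<Sum>i\<in>I. c i *\<^sub>R T (V i)) = (\<Sum>i\<in>I. c i) *\<^sub>R b + r *\<^sub>R (\<Sum>i\<in>I. c i *\<^sub>R f (V i))"
    by (simp add: f(2) scaleR_add_right sum.distrib scaleR_sum_left scaleR_sum_right mult.commute)
  then show ?thesis
    by (simp add: assms(2) f(2) lin)
qed

lemma similarity_affine_hull_2:
  assumes "similarity T"
  shows "T ` (affine hull {p, q}) = affine hull {T p, T q}"
proof -
  have "T (u *\<^sub>R p + v *\<^sub>R q) = u *\<^sub>R T p + v *\<^sub>R T q" if "u + v = 1" for u v
    using similarity_sum[OF assms, of "\<lambda>b. if b then u else v" UNIV "\<lambda>b. if b then p else q"] that
    by (simp add: UNIV_bool add.commute)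
  then show ?thesis
    unfolding affine_hull_2 image_def by (auto; metis)
qed

lemma plane_line_eq:
  assumes "L \<in> plane_lines" "p \<in> L" "q \<in> L" "p \<noteq> q"
  shows "L = affine hull {p, q}"
proof -
  obtain a b where L: "L = affine hull {a, b}" "a \<noteq> b"
    using assms(1) unfolding plane_lines_def by blast
  have "affine L"
    by (simp add: L(1))
  moreover have "aff_dim L = 1" "aff_dim {p, q} = 1"
    using L assms(4) by (simp_all add: aff_dim_2)
  ultimately show ?thesis
    using assms(2,3) affine_dim_equal[of "affine hull {p, q}" L]
    by (metis aff_dim_affine_hull affine_affine_hull affine_hull_eq_empty empty_subsetI
        hull_minimal insert_not_empty insert_subset)
qed

lemma plane_line_subset_eq:
  assumes "L \<in> plane_lines" "M \<in> plane_lines" "L \<subseteq> M"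
  shows "L = M"
proof -
  obtain a b where L: "L = affine hull {a, b}" "a \<noteq> b"
    using assms(1) unfolding plane_lines_def by blast
  have "a \<in> M" "b \<in> M"
    using L assms(3) hull_inc by (metis insertCI subsetD)+
  then show ?thesis
    using plane_line_eq[OF assms(2) _ _ L(2)] L(1) by blast
qed

lemma similarity_image_plane_line:
  assumes "similarity T" "L \<in> plane_lines"
  shows "T ` L \<in> plane_lines"
proof -
  obtain a b where L: "L = affine hull {a, b}" "a \<noteq> b"
    using assms(2) unfolding plane_lines_def by blast
  have "T a \<noteq> T b"
    using L(2) similarity_inj[OF assms(1)] by (simp add: inj_eq)
  then show ?thesis
    unfolding plane_lines_def L(1) similarity_affine_hull_2[OF assms(1)] by blast
qed

text \<open>The map is the reflection in the line through \<open>p\<close> and \<open>q\<close>.\<close>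

lemma line_reflection:
  fixes p q :: point
  assumes "p \<noteq> q"
  obtains T where "similarity T" "\<And>x. T x = x \<longleftrightarrow> x \<in> affine hull {p, q}"
proof -
  define d where "d = q - p"
  define R where "R y = (2 * (y \<bullet> d) / (d \<bullet> d)) *\<^sub>R d - y" for y
  define T where "T x = p + R (x - p)" for x
  have d: "d \<bullet> d \<noteq> 0"
    using assms by (simp add: d_def)
  have "R y \<bullet> R y = y \<bullet> y" for y
    using d by (simp add: R_def inner_diff_left inner_diff_right inner_commute field_simps)
  then have "norm (R y) = norm y" for y
    by (simp add: norm_eq_sqrt_inner)
  moreover have "T x - T y = R (x - y)" for x y
    by (simp add: T_def R_def inner_diff_left algebra_simps diff_divide_distrib)
  ultimately have "dist (T x) (T y) = dist x y" for x y
    by (simp add: dist_norm)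
  then have sim: "similarity T"
    unfolding similarity_def by (intro exI[of _ 1]) simp
  have "T x = x \<longleftrightarrow> x \<in> affine hull {p, q}" for x
  proof
    assume "T x = x"
    then have "2 *\<^sub>R (x - p) = (2 * ((x - p) \<bullet> d) / (d \<bullet> d)) *\<^sub>R d"
      by (simp add: T_def R_def algebra_simps scaleR_2)
    then have "(1/2) *\<^sub>R (2 *\<^sub>R (x - p)) = (((x - p) \<bullet> d) / (d \<bullet> d)) *\<^sub>R d"
      by simp
    then have "x = p + (((x - p) \<bullet> d) / (d \<bullet> d)) *\<^sub>R (q - p)"
      by (simp add: d_def algebra_simps)
    then show "x \<in> affine hull {p, q}"
      unfolding affine_hull_2_alt by blast
  next
    assume "x \<in> affine hull {p, q}"
    then obtain u where "x = p + u *\<^sub>R d"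
      unfolding affine_hull_2_alt d_def by blast
    then show "T x = x"
      using d by (simp add: T_def R_def algebra_simps flip: scaleR_add_left)
  qed
  then show thesis
    using that sim by blast
qed

lemma quarter_turn:
  fixes c :: point
  obtains T where "similarity T" "T c = c"
    "\<And>L. L \<in> plane_lines \<Longrightarrow> c \<in> L \<Longrightarrow> T ` L \<noteq> L"
proof -
  define J :: "point \<Rightarrow> point" where "J y = vector [- vec_nth y 2, vec_nth y 1]" for y
  define T where "T x = c + J (x - c)" for x
  have J1: "vec_nth (J y) 1 = - vec_nth y 2" and J2: "vec_nth (J y) 2 = vec_nth y 1" for y
    by (simp_all add: J_def)
  have inner2: "x \<bullet> y = vec_nth x 1 * vec_nth y 1 + vec_nth x 2 * vec_nth y 2" for x y :: point
    by (simp add: inner_vec_def sum_2)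
  have "norm (J y) = norm y" for y
    by (simp add: norm_eq_sqrt_inner inner2 J1 J2)
  moreover have "T x - T y = J (x - y)" for x y
    by (simp add: T_def Finite_Cartesian_Product.vec_eq_iff forall_2 J1 J2)
  ultimately have "dist (T x) (T y) = dist x y" for x y
    by (simp add: dist_norm)
  then have sim: "similarity T"
    unfolding similarity_def by (intro exI[of _ 1]) simp
  have Tc: "T c = c"
    by (simp add: T_def Finite_Cartesian_Product.vec_eq_iff forall_2 J1 J2)
  have "T ` L \<noteq> L" if L: "L \<in> plane_lines" "c \<in> L" for L
  proof
    assume inv: "T ` L = L"
    obtain a b where "L = affine hull {a, b}" "a \<noteq> b"
      using L(1) unfolding plane_lines_def by blast
    then obtain q where q: "q \<in> L" "c \<noteq> q"
      using hull_inc by (metis insertCI)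
    have "T q \<in> affine hull {c, q}"
      using q inv plane_line_eq[OF L q] by blast
    then obtain u where "T q = c + u *\<^sub>R (q - c)"
      unfolding affine_hull_2_alt by blast
    then have "J (q - c) = u *\<^sub>R (q - c)"
      by (simp add: T_def)
    moreover have "J (q - c) \<bullet> (q - c) = 0" "J (q - c) \<bullet> J (q - c) = (q - c) \<bullet> (q - c)"
      by (simp_all add: inner2 J1 J2 algebra_simps)
    ultimately have "(q - c) \<bullet> (q - c) = 0"
      by (metis inner_scaleR_right mult_zero_right)
    then show False
      using q(2) by simp
  qed
  then show thesis
    using that sim Tc by blast
qed

section \<open>Relabellings\<close>

lemma dihedral_bij_betw:
  assumes "\<alpha> \<in> dihedral n"
  shows "bij_betw \<alpha> {..<n} {..<n}"
proof -
  have "bij_betw (label_shift n) {..<n} {..<n}"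
  proof (rule bij_betw_byWitness[where f' = "\<lambda>i. (i + (n - 1)) mod n"])
    show "\<forall>i\<in>{..<n}. (label_shift n i + (n - 1)) mod n = i"
    proof
      fix i assume i: "i \<in> {..<n}"
      have "((i + 1) mod n + (n - 1)) mod n = (i + 1 + (n - 1)) mod n"
        by (rule mod_add_left_eq)
      also have "i + 1 + (n - 1) = i + n"
        using i by simp
      finally show "(label_shift n i + (n - 1)) mod n = i"
        using i by (simp add: label_shift_def)
    qed
    show "\<forall>i\<in>{..<n}. label_shift n ((i + (n - 1)) mod n) = i"
    proof
      fix i assume i: "i \<in> {..<n}"
      have "((i + (n - 1)) mod n + 1) mod n = (i + (n - 1) + 1) mod n"
        by (rule mod_add_left_eq)
      also have "i + (n - 1) + 1 = i + n"
        using i by simp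
      finally show "label_shift n ((i + (n - 1)) mod n) = i"
        using i by (simp add: label_shift_def)
    qed
  qed (auto simp: label_shift_def)
  moreover have "bij_betw (label_flip n) {..<n} {..<n}"
  proof (rule bij_betw_byWitness[where f' = "label_flip n"])
    have "label_flip n (label_flip n i) = i" if "i < n" for i
      using that by (cases "i = 0") (auto simp: label_flip_def)
    then show "\<forall>i\<in>{..<n}. label_flip n (label_flip n i) = i"
      "\<forall>i\<in>{..<n}. label_flip n (label_flip n i) = i"
      by auto
  qed (auto simp: label_flip_def)
  ultimately have "{label_shift n, label_flip n} \<subseteq> carrier (BijGroup {..<n})"
    by (auto simp: BijGroup_def Bij_def label_shift_def label_flip_def)
  then have "\<alpha> \<in> carrier (BijGroup {..<n})"
    using group.generate_in_carrier[OF group_BijGroup] assms unfolding dihedral_def by blast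
  then show ?thesis
    by (simp add: BijGroup_def Bij_def)
qed

lemma sum_relabel:
  assumes "\<alpha> \<in> dihedral n" "length P = n"
  shows "(\<Sum>i<n. g (\<alpha> i) (relabel \<alpha> P ! i)) = (\<Sum>i<n. g i (P ! i))"
proof -
  have "(\<Sum>i<n. g (\<alpha> i) (relabel \<alpha> P ! i)) = (\<Sum>i<n. (\<lambda>i. g i (P ! i)) (\<alpha> i))"
    by (rule sum.cong) (auto simp: relabel_def assms(2))
  also have "\<dots> = (\<Sum>i<n. g i (P ! i))"
    by (rule sum.reindex_bij_betw[OF dihedral_bij_betw[OF assms(1)]])
  finally show ?thesis .
qed

section \<open>Barycentric coordinates given by affine functions\<close>

text \<open>
  The operator \<open>u \<mapsto> \<Sum>(u \<bullet> v\<^sub>i) v\<^sub>i\<close> vanishes at \<open>u\<close> only if \<open>u\<close> is orthogonal to every \<open>v\<^sub>i\<close>, because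
  the inner product of its value with \<open>u\<close> is \<open>\<Sum>(u \<bullet> v\<^sub>i)\<^sup>2\<close>.
\<close>

lemma frame_operator_kernel:
  fixes v :: "'i \<Rightarrow> 'a::real_inner"
  assumes "finite I" "(\<Sum>i\<in>I. (u \<bullet> v i) *\<^sub>R v i) = 0" "i \<in> I"
  shows "u \<bullet> v i = 0"
proof -
  have "(\<Sum>i\<in>I. (u \<bullet> v i)\<^sup>2) = u \<bullet> (\<Sum>i\<in>I. (u \<bullet> v i) *\<^sub>R v i)"
    by (simp add: inner_sum_right power2_eq_square)
  also have "\<dots> = 0"
    by (simp add: assms(2))
  finally have "\<forall>i\<in>I. (u \<bullet> v i)\<^sup>2 = 0"
    using assms(1) by (simp add: sum_nonneg_eq_0_iff)
  then show ?thesis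
    using assms(3) by simp
qed

text \<open>
  Every linear combination of the \<open>v\<^sub>i\<close> is a value of this operator: the operator is self-adjoint, so the
  orthogonal complement of its range is its kernel, and the kernel is orthogonal to all \<open>v\<^sub>i\<close>.
\<close>

lemma frame_operator_range:
  fixes v :: "'i \<Rightarrow> 'a::euclidean_space"
  assumes "finite I"
  obtains u where "(\<Sum>i\<in>I. (u \<bullet> v i) *\<^sub>R v i) = (\<Sum>i\<in>I. c i *\<^sub>R v i)"
proof -
  define M where "M u = (\<Sum>i\<in>I. (u \<bullet> v i) *\<^sub>R v i)" for u
  have "linear M"
    unfolding M_def by (rule linearI)
      (simp_all add: inner_add_left scaleR_add_left sum.distrib scaleR_sum_right)
  then have sub: "Real_Vector_Spaces.subspace (range M)"
    using linear_subspace_image subspace_UNIV by blast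
  have sym: "M u \<bullet> y = u \<bullet> M y" for u y
    by (simp add: M_def inner_sum_left inner_sum_right inner_commute mult.commute)
  have "y \<bullet> (\<Sum>i\<in>I. c i *\<^sub>R v i) = 0" if "y \<in> (range M)\<^sup>\<bottom>" for y
  proof -
    have "M u \<bullet> y = 0" for u
      using that by (auto simp: orthogonal_comp_def real_inner_class.orthogonal_def inner_commute)
    then have "M y = 0"
      by (metis sym inner_eq_zero_iff)
    then have "\<forall>i\<in>I. y \<bullet> v i = 0"
      using frame_operator_kernel[OF assms] unfolding M_def by blast
    then show ?thesis
      by (simp add: inner_sum_right)
  qed
  then have "(\<Sum>i\<in>I. c i *\<^sub>R v i) \<in> (range M)\<^sup>\<bottom>\<^sup>\<bottom>"
    unfolding orthogonal_comp_def[of "(range M)\<^sup>\<bottom>"] real_inner_class.orthogonal_def by blast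
  then have "(\<Sum>i\<in>I. c i *\<^sub>R v i) \<in> range M"
    using orthogonal_comp_self[OF sub] by simp
  then obtain u where "M u = (\<Sum>i\<in>I. c i *\<^sub>R v i)"
    by (metis rangeE)
  then show thesis
    using that unfolding M_def by blast
qed

text \<open>
  Both lemmas below apply the frame operator to the lifted points \<open>(1, V i)\<close>, for which
  \<open>(a, w) \<bullet> (1, V i) = a + w \<bullet> V i\<close> is the value of an affine function at \<open>V i\<close>.
\<close>

lemma affine_weights_unique:
  fixes V :: "'i \<Rightarrow> 'a::real_inner"
  assumes "finite I" "(\<Sum>i\<in>I. a + w \<bullet> V i) = 0" "(\<Sum>i\<in>I. (a + w \<bullet> V i) *\<^sub>R V i) = 0" "i \<in> I"
  shows "a + w \<bullet> V i = 0"
proof -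
  have "(\<Sum>i\<in>I. ((a, w) \<bullet> (1, V i)) *\<^sub>R (1, V i)) = (0 :: real \<times> 'a)"
    using assms(2,3) by (simp add: prod_eq_iff fst_sum snd_sum)
  then have "(a, w) \<bullet> (1, V i) = 0"
    using frame_operator_kernel[OF assms(1), where u = "(a, w)" and v = "\<lambda>i. (1, V i)"] assms(4) by blast
  then show ?thesis
    by simp
qed

lemma affine_weights_exist:
  fixes V :: "'i \<Rightarrow> 'a::euclidean_space"
  assumes "finite I" "X \<in> affine hull (V ` I)"
  obtains a w where "(\<Sum>i\<in>I. a + w \<bullet> V i) = 1" "(\<Sum>i\<in>I. (a + w \<bullet> V i) *\<^sub>R V i) = X"
proof -
  \<comment> \<open>Points of the hull need coordinates indexed by \<open>I\<close>, although \<open>V\<close> may repeat values.\<close>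
  define H where "H = {\<Sum>i\<in>I. c i *\<^sub>R V i | c. sum c I = 1}"
  have "affine H"
    unfolding affine_def
  proof (intro ballI allI impI)
    fix x y and s t :: real
    assume "x \<in> H" "y \<in> H" and st: "s + t = 1"
    then obtain c e where c: "sum c I = 1" "x = (\<Sum>i\<in>I. c i *\<^sub>R V i)"
      and e: "sum e I = 1" "y = (\<Sum>i\<in>I. e i *\<^sub>R V i)"
      unfolding H_def by blast
    have "sum (\<lambda>i. s * c i + t * e i) I = 1"
      using c(1) e(1) st by (simp add: sum.distrib flip: sum_distrib_left)
    moreover have "s *\<^sub>R x + t *\<^sub>R y = (\<Sum>i\<in>I. (s * c i + t * e i) *\<^sub>R V i)"
      by (simp add: c(2) e(2) scaleR_add_left sum.distrib scaleR_sum_right)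
    ultimately show "s *\<^sub>R x + t *\<^sub>R y \<in> H"
      unfolding H_def mem_Collect_eq by (intro exI[of _ "\<lambda>i. s * c i + t * e i"] conjI)
  qed
  moreover have "V j \<in> H" if "j \<in> I" for j
  proof -
    have "sum (\<lambda>i. if i = j then 1 else 0 :: real) I = 1"
      using assms(1) that by simp
    moreover have "(\<Sum>i\<in>I. (if i = j then 1 else 0 :: real) *\<^sub>R V i) = V j"
      using assms(1) that by (simp add: if_distrib[of "\<lambda>c. c *\<^sub>R _"] cong: if_cong)
    ultimately show ?thesis
      unfolding H_def mem_Collect_eq by (intro exI[of _ "\<lambda>i. if i = j then 1 else 0"]) simp
  qed
  ultimately have "affine hull (V ` I) \<subseteq> H"
    by (intro hull_minimal) auto
  then obtain c where c: "sum c I = 1" "X = (\<Sum>i\<in>I. c i *\<^sub>R V i)"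
    using assms(2) unfolding H_def by blast
  define lift where "lift i = (1 :: real, V i)" for i
  obtain u where u: "(\<Sum>i\<in>I. (u \<bullet> lift i) *\<^sub>R lift i) = (\<Sum>i\<in>I. c i *\<^sub>R lift i)"
    using frame_operator_range[OF assms(1)] by blast
  obtain a w where aw: "u = (a, w)"
    by (cases u)
  have "(\<Sum>i\<in>I. a + w \<bullet> V i) = sum c I"
    using arg_cong[OF u, of fst] by (simp add: aw lift_def fst_sum)
  moreover have "(\<Sum>i\<in>I. (a + w \<bullet> V i) *\<^sub>R V i) = (\<Sum>i\<in>I. c i *\<^sub>R V i)"
    using arg_cong[OF u, of snd] by (simp add: aw lift_def snd_sum)
  ultimately show thesis
    using that c by simp
qed

text \<open>
  The barycentric coordinates, with respect to the vertices of \<open>P\<close>, of points of \<open>L\<close>, as far as they arise by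
  evaluating an affine function \<open>X \<mapsto> a + w \<bullet> X\<close> of the plane at the vertices.
\<close>

definition affine_weights :: "nat \<Rightarrow> polygon \<Rightarrow> point set \<Rightarrow> real Matrix.vec set" where
  "affine_weights n P L = {x \<in> carrier_vec n.
     (\<exists>a w. \<forall>i<n. vec_index x i = a + w \<bullet> P ! i) \<and>
     (\<Sum>i<n. vec_index x i) = 1 \<and> (\<Sum>i<n. vec_index x i *\<^sub>R P ! i) \<in> L}"

lemma affine_weights_relabel:
  assumes "\<alpha> \<in> dihedral n" "length P = n" "x \<in> affine_weights n P L"
  shows "Matrix.vec n (\<lambda>i. vec_index x (\<alpha> i)) \<in> affine_weights n (relabel \<alpha> P) L"
proof -
  let ?y = "Matrix.vec n (\<lambda>i. vec_index x (\<alpha> i))"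
  have \<alpha>: "\<alpha> i < n" if "i < n" for i
    using bij_betwE[OF dihedral_bij_betw[OF assms(1)]] that by blast
  obtain a w where aw: "\<And>i. i < n \<Longrightarrow> vec_index x i = a + w \<bullet> P ! i"
    using assms(3) unfolding affine_weights_def by blast
  have "\<forall>i<n. vec_index ?y i = a + w \<bullet> relabel \<alpha> P ! i"
    using \<alpha> aw assms(2) by (simp add: relabel_def)
  moreover have "(\<Sum>i<n. vec_index ?y i) = 1"
    using sum_relabel[OF assms(1,2), of "\<lambda>i _. vec_index x i"] assms(3)
    by (simp add: affine_weights_def)
  moreover have "(\<Sum>i<n. vec_index ?y i *\<^sub>R relabel \<alpha> P ! i) \<in> L"
    using sum_relabel[OF assms(1,2), of "\<lambda>i X. vec_index x i *\<^sub>R X"] assms(3)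
    by (simp add: affine_weights_def)
  ultimately show ?thesis
    unfolding affine_weights_def by auto
qed

lemma affine_weights_similarity:
  assumes "similarity T" "length P = n" "x \<in> affine_weights n P L"
  shows "x \<in> affine_weights n (map T P) (T ` L)"
proof -
  obtain b r f where r: "r > 0" and f: "orthogonal_transformation f" "\<And>x. T x = b + r *\<^sub>R f x"
    using similarityE[OF assms(1)] by metis
  obtain a w where aw: "\<And>i. i < n \<Longrightarrow> vec_index x i = a + w \<bullet> P ! i"
    using assms(3) unfolding affine_weights_def by blast
  have x: "(\<Sum>i<n. vec_index x i) = 1" "(\<Sum>i<n. vec_index x i *\<^sub>R P ! i) \<in> L"
    using assms(3) by (simp_all add: affine_weights_def)
  \<comment> \<open>The affine function \<open>X \<mapsto> a + w \<bullet> X\<close> precomposed with the inverse of \<open>T\<close> has gradient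
    \<open>w'\<close>; no inverse is needed, as \<open>f\<close> preserves inner products.\<close>
  define w' where "w' = (1 / r) *\<^sub>R f w"
  have "\<forall>i<n. vec_index x i = (a - w' \<bullet> b) + w' \<bullet> map T P ! i"
  proof (intro allI impI)
    fix i assume "i < n"
    have "w' \<bullet> T (P ! i) = w' \<bullet> b + w \<bullet> P ! i"
      using r f by (simp add: w'_def inner_add_right orthogonal_transformation_def)
    then show "vec_index x i = (a - w' \<bullet> b) + w' \<bullet> map T P ! i"
      using \<open>i < n\<close> aw assms(2) by simp
  qed
  moreover have "(\<Sum>i<n. vec_index x i *\<^sub>R map T P ! i) \<in> T ` L"
  proof -
    have "(\<Sum>i<n. vec_index x i *\<^sub>R map T P ! i) = (\<Sum>i<n. vec_index x i *\<^sub>R T (P ! i))"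
      using assms(2) by simp
    also have "\<dots> = T (\<Sum>i<n. vec_index x i *\<^sub>R P ! i)"
      using similarity_sum[OF assms(1) x(1), of "(!) P"] by simp
    finally show ?thesis
      using x(2) by simp
  qed
  ultimately show ?thesis
    using assms(3) x(1) unfolding affine_weights_def by blast
qed

text \<open>
  If the line \<open>L\<close> lies in the affine hull of the vertices, its affine weights form a line \<open>{p + t v | t}\<close> in the
  hyperplane of coordinate sum \<open>1\<close>, and they yield all points of \<open>L\<close>.
\<close>

lemma affine_weights_line:
  assumes "length P = n" "L \<in> plane_lines" "L \<subseteq> affine hull (set P)"
  obtains p v where "(\<Sum>i<n. p i) = 1" "(\<Sum>i<n. v i) = 0" "\<exists>k<n. v k \<noteq> 0"
    "affine_weights n P L = {Matrix.vec n (\<lambda>i. p i + t * v i) | t. True}"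
    "L = {\<Sum>i<n. vec_index x i *\<^sub>R P ! i | x. x \<in> affine_weights n P L}"
proof -
  obtain A B where L: "L = affine hull {A, B}" "A \<noteq> B"
    using assms(2) unfolding plane_lines_def by blast
  have set_P: "set P = (!) P ` {..<n}"
    using assms(1) by (auto simp: set_conv_nth)
  have AB: "A \<in> affine hull ((!) P ` {..<n})" "B \<in> affine hull ((!) P ` {..<n})"
    using assms(3) hull_subset[of "{A, B}" affine] unfolding L(1) set_P by auto
  obtain a w where A: "(\<Sum>i<n. a + w \<bullet> P ! i) = 1" "(\<Sum>i<n. (a + w \<bullet> P ! i) *\<^sub>R P ! i) = A"
    using affine_weights_exist[OF finite_lessThan AB(1)] by blast
  obtain a' w' where B: "(\<Sum>i<n. a' + w' \<bullet> P ! i) = 1" "(\<Sum>i<n. (a' + w' \<bullet> P ! i) *\<^sub>R P ! i) = B"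
    using affine_weights_exist[OF finite_lessThan AB(2)] by blast
  \<comment> \<open>\<open>p + t v\<close> interpolates between the weights of \<open>A\<close> at \<open>t = 0\<close> and those of \<open>B\<close> at \<open>t = 1\<close>.\<close>
  define p where "p i = a + w \<bullet> P ! i" for i
  define v where "v i = (a' + w' \<bullet> P ! i) - (a + w \<bullet> P ! i)" for i
  have p: "(\<Sum>i<n. p i) = 1" "(\<Sum>i<n. p i *\<^sub>R P ! i) = A"
    using A by (simp_all add: p_def)
  have v: "(\<Sum>i<n. v i) = 0" "(\<Sum>i<n. v i *\<^sub>R P ! i) = B - A"
    unfolding v_def scaleR_diff_left sum_subtractf A B by simp_all
  have "\<exists>k<n. v k \<noteq> 0"
  proof (rule ccontr)
    assume "\<not> ?thesis"
    then have "(\<Sum>i<n. v i *\<^sub>R P ! i) = 0"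
      by simp
    then show False
      using v(2) L(2) by simp
  qed
  have pv_sum: "(\<Sum>i<n. p i + t * v i) = 1" for t
    using p(1) v(1) by (simp add: sum.distrib flip: sum_distrib_left)
  have pv_point: "(\<Sum>i<n. (p i + t * v i) *\<^sub>R P ! i) = A + t *\<^sub>R (B - A)" for t
    by (simp add: scaleR_add_left sum.distrib p(2) flip: scaleR_scaleR scaleR_sum_right v(2))
  have pv_form: "p i + t * v i = (a + t * (a' - a)) + (w + t *\<^sub>R (w' - w)) \<bullet> P ! i" for t i
    by (simp add: p_def v_def inner_add_left inner_diff_left algebra_simps)
  have L': "X \<in> L \<longleftrightarrow> (\<exists>t. X = A + t *\<^sub>R (B - A))" for X
    unfolding L(1) affine_hull_2_alt by blast
  have mem: "Matrix.vec n (\<lambda>i. p i + t * v i) \<in> affine_weights n P L" for t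
  proof -
    have "\<exists>a w. \<forall>i<n. p i + t * v i = a + w \<bullet> P ! i"
      using pv_form by blast
    moreover have "A + t *\<^sub>R (B - A) \<in> L"
      using L' by blast
    ultimately show ?thesis
      by (simp add: affine_weights_def pv_sum pv_point)
  qed
  have "\<exists>t. x = Matrix.vec n (\<lambda>i. p i + t * v i)" if x: "x \<in> affine_weights n P L" for x
  proof -
    obtain t where t: "(\<Sum>i<n. vec_index x i *\<^sub>R P ! i) = A + t *\<^sub>R (B - A)"
      using x L' unfolding affine_weights_def by blast
    obtain c u where cu: "\<And>i. i < n \<Longrightarrow> vec_index x i = c + u \<bullet> P ! i"
      using x unfolding affine_weights_def by blast
    \<comment> \<open>\<open>x\<close> and \<open>p + t v\<close> belong to the same point, so the difference of their affine functions
      vanishes at the vertices.\<close>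
    define c' where "c' = c - (a + t * (a' - a))"
    define u' where "u' = u - (w + t *\<^sub>R (w' - w))"
    have diff: "c' + u' \<bullet> P ! i = vec_index x i - (p i + t * v i)" if "i < n" for i
      unfolding cu[OF that] pv_form c'_def u'_def by (simp add: inner_diff_left)
    have "(\<Sum>i<n. c' + u' \<bullet> P ! i) = (\<Sum>i<n. vec_index x i - (p i + t * v i))"
      by (intro sum.cong) (simp_all add: diff)
    also have "\<dots> = 0"
      using x pv_sum by (simp only: sum_subtractf affine_weights_def) simp
    finally have s1: "(\<Sum>i<n. c' + u' \<bullet> P ! i) = 0" .
    have "(\<Sum>i<n. (c' + u' \<bullet> P ! i) *\<^sub>R P ! i)
        = (\<Sum>i<n. vec_index x i *\<^sub>R P ! i - (p i + t * v i) *\<^sub>R P ! i)"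
      by (intro sum.cong) (simp_all add: diff scaleR_diff_left)
    also have "\<dots> = 0"
      by (simp only: sum_subtractf t pv_point) simp
    finally have s2: "(\<Sum>i<n. (c' + u' \<bullet> P ! i) *\<^sub>R P ! i) = 0" .
    have "vec_index x i = p i + t * v i" if "i < n" for i
      using affine_weights_unique[OF finite_lessThan s1 s2] diff[OF that] that by simp
    then have "x = Matrix.vec n (\<lambda>i. p i + t * v i)"
      using x by (intro eq_vecI) (auto simp: affine_weights_def)
    then show ?thesis ..
  qed
  then have weights: "affine_weights n P L = {Matrix.vec n (\<lambda>i. p i + t * v i) | t. True}"
    using mem by blast
  have "X \<in> {\<Sum>i<n. vec_index x i *\<^sub>R P ! i | x. x \<in> affine_weights n P L}" if X: "X \<in> L" for X
  proof -
    obtain t where "X = A + t *\<^sub>R (B - A)"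
      using X L' by blast
    then have "X = (\<Sum>i<n. vec_index (Matrix.vec n (\<lambda>i. p i + t * v i)) i *\<^sub>R P ! i)"
      by (simp add: pv_point)
    then show ?thesis
      using mem by blast
  qed
  then have "L = {\<Sum>i<n. vec_index x i *\<^sub>R P ! i | x. x \<in> affine_weights n P L}"
    unfolding affine_weights_def by blast
  then show thesis
    using that p(1) v(1) \<open>\<exists>k<n. v k \<noteq> 0\<close> weights by blast
qed

section \<open>Lines as solution sets of linear systems\<close>

lemma (in vec_space) full_row_rank:
  assumes "A \<in> carrier_mat n m"
    and "\<And>y. y \<in> carrier_vec n \<Longrightarrow> \<exists>x\<in>carrier_vec m. A *\<^sub>v x = y"
  shows "rank A = n"
proof -
  have "col_space A = carrier_vec n"
    using assms by (auto simp: col_space_eq)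
  then have "span (set (cols A)) = carrier_vec n"
    unfolding col_space_def .
  moreover have "vs (carrier_vec n) = V"
    by (simp add: module_vec_def)
  ultimately show ?thesis
    unfolding rank_def by (simp only: dim_is_n)
qed

text \<open>
  Choose \<open>k\<close> with \<open>v\<^sub>k \<noteq> 0\<close> and some \<open>l \<noteq> k\<close>. For each of the remaining \<open>n - 2\<close> indices \<open>j\<close>, take the
  row \<open>x\<^sub>j - (v\<^sub>j / v\<^sub>k) x\<^sub>k - q\<^sub>j \<Sum>x\<^sub>i\<close>, where \<open>q\<^sub>j = p\<^sub>j - v\<^sub>j p\<^sub>k / v\<^sub>k\<close> makes it vanish at \<open>p\<close>
  as well as at \<open>v\<close>. Conversely, these rows determine each such \<open>x\<^sub>j\<close> from \<open>x\<^sub>k\<close>, and the coordinate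
  sum determines \<open>x\<^sub>l\<close>. The system is solvable for every right-hand side, hence of full rank.
\<close>

lemma line_as_solution_set:
  fixes p v :: "nat \<Rightarrow> real"
  assumes "n \<ge> 2" and p: "(\<Sum>i<n. p i) = 1" and v: "(\<Sum>i<n. v i) = 0" "\<exists>k<n. v k \<noteq> 0"
  obtains c :: "nat \<Rightarrow> nat \<Rightarrow> real" where
    "{x \<in> carrier_vec n. mat (n - 1) n (\<lambda>(i, j). if i = 0 then 1 else c i j) *\<^sub>v x = unit_vec (n - 1) 0}
       = {Matrix.vec n (\<lambda>i. p i + t * v i) | t. True}"
    "vec_space.rank (n - 1) (mat (n - 1) n (\<lambda>(i, j). if i = 0 then 1 else c i j)) = n - 1"
proof -
  obtain k where k: "k < n" "v k \<noteq> 0"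
    using v(2) by blast
  obtain l where l: "l < n" "l \<noteq> k"
    using assms(1) that[of 0] that[of 1] by (cases "k = 0") auto
  \<comment> \<open>The row with number \<open>i\<close>, \<open>1 \<le> i < n - 1\<close>, belongs to the index \<open>e i\<close>.\<close>
  define R where "R = {..<n} - {k, l}"
  have "card R = n - 2"
    using k l by (simp add: R_def card_Diff_subset)
  then have "card {1..<n - 1} = card R"
    by simp
  then obtain e where e: "bij_betw e {1..<n - 1} R"
    using finite_same_card_bij[of "{1..<n - 1}" R] by (auto simp: R_def)
  have split: "(\<Sum>j<n. g j) = g l + g k + sum g R" for g :: "nat \<Rightarrow> real"
  proof -
    have R: "finite R" "k \<notin> R" "l \<notin> R"
      by (simp_all add: R_def)
    have "{..<n} = insert l (insert k R)"
      using k l by (auto simp: R_def)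
    then have "(\<Sum>j<n. g j) = sum g (insert l (insert k R))"
      by simp
    then show ?thesis
      using l R by simp
  qed
  define q where "q j = p j - v j * p k / v k" for j
  define c where "c i j = (if j = e i then 1 else 0) - (if j = k then v (e i) / v k else 0) - q (e i)"
    for i j
  define A where "A = mat (n - 1) n (\<lambda>(i, j). if i = 0 then 1 else c i j)"
  have A_carrier: "A \<in> carrier_mat (n - 1) n"
    by (simp add: A_def)
  have e_mem: "e i < n" "e i \<noteq> k" "e i \<noteq> l" if "1 \<le> i" "i < n - 1" for i
    using bij_betwE[OF e] that by (auto simp: R_def)
  have row0: "vec_index (A *\<^sub>v x) 0 = (\<Sum>j<n. vec_index x j)" if "x \<in> carrier_vec n" for x
    using that assms(1) by (simp add: A_def scalar_prod_def lessThan_atLeast0)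
  have row: "vec_index (A *\<^sub>v x) i
      = vec_index x (e i) - v (e i) / v k * vec_index x k - q (e i) * (\<Sum>j<n. vec_index x j)"
    if x: "x \<in> carrier_vec n" and i: "1 \<le> i" "i < n - 1" for x i
  proof -
    have "vec_index (A *\<^sub>v x) i = (\<Sum>j<n. c i j * vec_index x j)"
      using x i by (simp add: A_def scalar_prod_def lessThan_atLeast0)
    also have "\<dots> = (\<Sum>j<n. (if j = e i then vec_index x j else 0)
        - (if j = k then v (e i) / v k * vec_index x j else 0) - q (e i) * vec_index x j)"
      by (intro sum.cong) (auto simp: c_def algebra_simps)
    finally show ?thesis
      using e_mem[OF i] k by (simp add: sum_subtractf sum_distrib_left)
  qed
  have "{x \<in> carrier_vec n. A *\<^sub>v x = unit_vec (n - 1) 0}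
      = {Matrix.vec n (\<lambda>i. p i + t * v i) | t. True}" (is "?S = ?L")
  proof
    show "?L \<subseteq> ?S"
    proof
      fix x assume "x \<in> ?L"
      then obtain t where t: "x = Matrix.vec n (\<lambda>i. p i + t * v i)"
        by blast
      have x: "x \<in> carrier_vec n"
        by (simp add: t)
      have sum_x: "(\<Sum>j<n. vec_index x j) = 1"
        using p v(1) by (simp add: t sum.distrib flip: sum_distrib_left)
      have "A *\<^sub>v x = unit_vec (n - 1) 0"
      proof (rule eq_vecI)
        fix i assume "i < dim_vec (unit_vec (n - 1) 0 :: real Matrix.vec)"
        then have i: "i < n - 1"
          by simp
        show "vec_index (A *\<^sub>v x) i = vec_index (unit_vec (n - 1) 0) i"
        proof (cases "i = 0")
          case True
          then show ?thesis
            using row0[OF x] sum_x i by simp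
        next
          case False
          then have i1: "1 \<le> i"
            by simp
          have "vec_index (A *\<^sub>v x) i
              = (p (e i) + t * v (e i)) - v (e i) / v k * (p k + t * v k) - q (e i)"
            unfolding row[OF x i1 i] sum_x using e_mem[OF i1 i] k by (simp add: t)
          also have "\<dots> = 0"
            using k by (simp add: q_def field_simps)
          finally have "vec_index (A *\<^sub>v x) i = 0" .
          then show ?thesis
            using False i by simp
        qed
      qed (simp add: A_def)
      then show "x \<in> ?S"
        using x by simp
    qed
  next
    show "?S \<subseteq> ?L"
    proof
      fix x assume "x \<in> ?S"
      then have x: "x \<in> carrier_vec n" and Ax: "A *\<^sub>v x = unit_vec (n - 1) 0"
        by auto
      have sum_x: "(\<Sum>j<n. vec_index x j) = 1"
        using row0[OF x] assms(1) by (simp add: Ax)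
      \<comment> \<open>The parameter is read off from the coordinate \<open>k\<close>.\<close>
      define t where "t = (vec_index x k - p k) / v k"
      have xk: "vec_index x k = p k + t * v k"
        using k by (simp add: t_def)
      have xR: "vec_index x j = p j + t * v j" if j: "j \<in> R" for j
      proof -
        obtain i where i: "1 \<le> i" "i < n - 1" "j = e i"
          using j bij_betw_imp_surj_on[OF e] by auto
        have "vec_index x (e i) - v (e i) / v k * vec_index x k - q (e i) = 0"
          using row[OF x i(1,2)] i by (simp add: Ax sum_x)
        moreover have "v (e i) / v k * vec_index x k = v (e i) * p k / v k + t * v (e i)"
          using k by (simp add: xk field_simps)
        ultimately show ?thesis
          by (simp add: i(3) q_def)
      qed
      have "(\<Sum>j<n. vec_index x j) = (\<Sum>j<n. p j + t * v j)"
        using p v(1) sum_x by (simp add: sum.distrib flip: sum_distrib_left)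
      moreover have "sum (vec_index x) R = (\<Sum>j\<in>R. p j + t * v j)"
        by (intro sum.cong) (simp_all add: xR)
      ultimately have xl: "vec_index x l = p l + t * v l"
        unfolding split using xk by simp
      have "x = Matrix.vec n (\<lambda>i. p i + t * v i)"
      proof (rule eq_vecI)
        fix j assume "j < dim_vec (Matrix.vec n (\<lambda>i. p i + t * v i))"
        then have "j = k \<or> j = l \<or> j \<in> R" "j < n"
          by (auto simp: R_def)
        then show "vec_index x j = vec_index (Matrix.vec n (\<lambda>i. p i + t * v i)) j"
          using xk xl xR by auto
      qed (use x in simp)
      then show "x \<in> ?L"
        by blast
    qed
  qed
  moreover have "vec_space.rank (n - 1) A = n - 1"
  proof (rule vec_space.full_row_rank[OF A_carrier])
    fix y :: "real Matrix.vec"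
    assume y: "y \<in> carrier_vec (n - 1)"
    \<comment> \<open>A solution with \<open>x\<^sub>k = 0\<close> and prescribed sum \<open>y\<^sub>0\<close>; the entry \<open>l\<close> adjusts the sum.\<close>
    define g where "g j = vec_index y (inv_into {1..<n - 1} e j) + q j * vec_index y 0" for j
    define x where "x = Matrix.vec n (\<lambda>j. if j = l then vec_index y 0 - sum g R
      else if j = k then 0 else g j)"
    have x: "x \<in> carrier_vec n"
      by (simp add: x_def)
    have xk: "vec_index x k = 0" and xl: "vec_index x l = vec_index y 0 - sum g R"
      using k l by (auto simp: x_def)
    have xR: "vec_index x j = g j" if "j \<in> R" for j
      using that by (auto simp: x_def R_def)
    have "sum (vec_index x) R = sum g R"
      by (intro sum.cong) (simp_all add: xR)
    then have sum_x: "(\<Sum>j<n. vec_index x j) = vec_index y 0"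
      unfolding split using xk xl by simp
    have "A *\<^sub>v x = y"
    proof (rule eq_vecI)
      fix i assume "i < dim_vec y"
      then have i: "i < n - 1"
        using y by simp
      show "vec_index (A *\<^sub>v x) i = vec_index y i"
      proof (cases "i = 0")
        case True
        then show ?thesis
          using row0[OF x] sum_x by simp
      next
        case False
        then have i1: "1 \<le> i"
          by simp
        have "e i \<in> R" "inv_into {1..<n - 1} e (e i) = i"
          using i i1 bij_betwE[OF e] inv_into_f_f[OF bij_betw_imp_inj_on[OF e]] by auto
        then show ?thesis
          using row[OF x i1 i] sum_x xR xk by (simp add: g_def)
      qed
    qed (use y in \<open>simp add: A_def\<close>)
    then show "\<exists>x\<in>carrier_vec n. A *\<^sub>v x = y"
      using x by blast
  qed
  ultimately show thesis
    using that unfolding A_def by blast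
qed

section \<open>Kimberling central lines\<close>

lemma Kimberling_imp_central_line:
  assumes "closed_family n F" "Kimberling_central_line n F \<Psi>"
  shows "central_line n F \<Psi>"
proof -
  have \<Psi>: "\<Psi> \<in> F \<rightarrow> plane_lines"
    using assms(2) unfolding Kimberling_central_line_def by blast
  obtain \<Phi> \<Phi>' where c: "center n F \<Phi>" "center n F \<Phi>'"
    and on: "\<And>P. P \<in> F \<Longrightarrow> \<Phi> P \<noteq> \<Phi>' P \<and> \<Phi> P \<in> \<Psi> P \<and> \<Phi>' P \<in> \<Psi> P"
    using assms(2) unfolding Kimberling_central_line_def by blast
  have line: "\<Psi> P = affine hull {\<Phi> P, \<Phi>' P}" if "P \<in> F" for P
    using plane_line_eq[of "\<Psi> P"] \<Psi> on[OF that] that by blast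
  have "\<Psi> (map T P) = T ` \<Psi> P" if "P \<in> F" "similarity T" for P T
  proof -
    have "map T P \<in> F"
      using assms(1) that unfolding closed_family_def by blast
    then show ?thesis
      using that c unfolding center_def by (simp add: line similarity_affine_hull_2)
  qed
  moreover have "\<Psi> P = \<Psi> Q" if "P \<in> F" "Q \<in> F" "differ_in_labelling n P Q" for P Q
  proof -
    have "\<Phi> P = \<Phi> Q" "\<Phi>' P = \<Phi>' Q"
      using that c unfolding center_def by blast+
    then show ?thesis
      using that by (simp add: line)
  qed
  ultimately show ?thesis
    using \<Psi> unfolding central_line_def by blast
qed

text \<open>The reflection in a line that carries all vertices fixes the polygon, hence every center of it.\<close>

lemma center_in_line_of_collinear_polygon:
  assumes "center n F \<Phi>" "P \<in> F" "set P \<subseteq> affine hull {p, q}" "p \<noteq> q"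
  shows "\<Phi> P \<in> affine hull {p, q}"
proof -
  obtain T where T: "similarity T" "\<And>x. T x = x \<longleftrightarrow> x \<in> affine hull {p, q}"
    using line_reflection[OF assms(4)] by blast
  have "map T P = P"
    using assms(3) T(2) by (intro map_idI) blast
  then have "T (\<Phi> P) = \<Phi> P"
    using assms(1,2) T(1) unfolding center_def by metis
  then show ?thesis
    using T(2) by blast
qed

lemma Kimberling_line_contains_collinear_polygon:
  assumes "Kimberling_central_line n F \<Psi>" "P \<in> F" "collinear (set P)"
  shows "set P \<subseteq> \<Psi> P"
proof -
  obtain \<Phi> \<Phi>' where c: "center n F \<Phi>" "center n F \<Phi>'"
    and on: "\<Phi> P \<noteq> \<Phi>' P" "\<Phi> P \<in> \<Psi> P" "\<Phi>' P \<in> \<Psi> P" and \<Psi>: "\<Psi> P \<in> plane_lines"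
    using assms(1,2) unfolding Kimberling_central_line_def by blast
  \<comment> \<open>If all vertices coincide, any line through them will do.\<close>
  obtain p q where pq: "set P \<subseteq> affine hull {p, q}" "p \<noteq> q"
  proof -
    obtain p q where "set P \<subseteq> affine hull {p, q}"
      using assms(3) unfolding collinear_affine_hull by blast
    moreover obtain q' where "q' \<noteq> p"
      by (metis add_cancel_right_right zero_neq_one Finite_Cartesian_Product.vec_eq_iff one_index zero_index)
    ultimately show thesis
      using that[of p q] that[of p q'] hull_mono[of "{p}" "{p, q'}" affine] by (cases "p = q") auto
  qed
  have "\<Phi> P \<in> affine hull {p, q}" "\<Phi>' P \<in> affine hull {p, q}"
    using center_in_line_of_collinear_polygon c assms(2) pq by blast+
  then have "affine hull {p, q} = affine hull {\<Phi> P, \<Phi>' P}"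
    using plane_line_eq[of "affine hull {p, q}"] on(1) pq(2) unfolding plane_lines_def by blast
  also have "\<dots> = \<Psi> P"
    using plane_line_eq[OF \<Psi> on(2,3,1)] by simp
  finally show ?thesis
    using pq(1) by simp
qed

section \<open>Central lines and linear systems\<close>

lemma solutions_sum:
  assumes "n \<ge> 2" "x \<in> solutions n a P"
  shows "(\<Sum>i<n. vec_index x i) = 1"
proof -
  have "x \<in> carrier_vec n" "coeff_matrix n a P *\<^sub>v x = unit_vec (n - 1) 0"
    using assms(2) by (simp_all add: solutions_def)
  then have "vec_index (coeff_matrix n a P *\<^sub>v x) 0 = 1"
    using assms(1) by simp
  then show ?thesis
    using assms(1) \<open>x \<in> carrier_vec n\<close>
    by (simp add: coeff_matrix_def scalar_prod_def lessThan_atLeast0)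
qed

text \<open>
  Only one inclusion has to be checked for either kind of invariance, since both sides are lines.
\<close>

lemma given_by_linear_systems_imp_central_line:
  assumes "n \<ge> 2" "closed_family n F" "\<Psi> \<in> F \<rightarrow> plane_lines" "given_by_linear_systems n F \<Psi>"
  shows "central_line n F \<Psi>"
proof -
  obtain a where a: "\<forall>P\<in>F. solutions n a P \<noteq> {} \<and>
      vec_space.rank (n - 1) (coeff_matrix n a P) = n - 1 \<and>
      \<Psi> P = {\<Sum>i<n. vec_index x i *\<^sub>R P ! i | x. x \<in> solutions n a P} \<and>
      (\<forall>\<alpha>\<in>dihedral n. \<forall>x\<in>solutions n a P.
         Matrix.vec n (\<lambda>i. vec_index x (\<alpha> i)) \<in> solutions n a (relabel \<alpha> P)) \<and>
      (\<forall>T. similarity T \<longrightarrow> (\<forall>x\<in>solutions n a P. x \<in> solutions n a (map T P)))"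
    using assms(4) unfolding given_by_linear_systems_def by (rule exE)
  have points: "\<Psi> P = {\<Sum>i<n. vec_index x i *\<^sub>R P ! i | x. x \<in> solutions n a P}" if "P \<in> F" for P
    using bspec[OF a that] by (elim conjE)
  have lab_sol: "Matrix.vec n (\<lambda>i. vec_index x (\<alpha> i)) \<in> solutions n a (relabel \<alpha> P)"
    if "P \<in> F" "\<alpha> \<in> dihedral n" "x \<in> solutions n a P" for P \<alpha> x
    using bspec[OF a that(1)] that(2,3) by (elim conjE) simp
  have sim: "x \<in> solutions n a (map T P)"
    if "P \<in> F" "similarity T" "x \<in> solutions n a P" for P T x
    using bspec[OF a that(1)] that(2,3) by (elim conjE) simp
  have len: "length P = n" if "P \<in> F" for P
    using assms(2) that unfolding closed_family_def polygons_def by blast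
  have "\<Psi> (map T P) = T ` \<Psi> P" if P: "P \<in> F" and T: "similarity T" for P T
  proof -
    have TP: "map T P \<in> F"
      using assms(2) P T unfolding closed_family_def by blast
    have "T X \<in> \<Psi> (map T P)" if X: "X \<in> \<Psi> P" for X
    proof -
      obtain x where x: "x \<in> solutions n a P" "X = (\<Sum>i<n. vec_index x i *\<^sub>R P ! i)"
        using X unfolding points[OF P] by blast
      have "(\<Sum>i<n. vec_index x i) = 1"
        by (rule solutions_sum[OF assms(1) x(1)])
      then have "T X = (\<Sum>i<n. vec_index x i *\<^sub>R T (P ! i))"
        unfolding x(2) using similarity_sum[OF T, of "vec_index x" _ "(!) P"] by simp
      also have "\<dots> = (\<Sum>i<n. vec_index x i *\<^sub>R map T P ! i)"
        using len[OF P] by simp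
      finally show ?thesis
        using sim[OF P T x(1)] unfolding points[OF TP] by blast
    qed
    then have "T ` \<Psi> P \<subseteq> \<Psi> (map T P)"
      by blast
    then show ?thesis
      using plane_line_subset_eq similarity_image_plane_line[OF T] assms(3) P TP by blast
  qed
  moreover have "\<Psi> P = \<Psi> Q" if P: "P \<in> F" and Q: "Q \<in> F" and lab: "differ_in_labelling n P Q" for P Q
  proof -
    obtain \<alpha> where \<alpha>: "\<alpha> \<in> dihedral n" "Q = relabel \<alpha> P"
      using lab unfolding differ_in_labelling_def by blast
    have "X \<in> \<Psi> Q" if X: "X \<in> \<Psi> P" for X
    proof -
      obtain x where x: "x \<in> solutions n a P" "X = (\<Sum>i<n. vec_index x i *\<^sub>R P ! i)"
        using X unfolding points[OF P] by blast
      let ?y = "Matrix.vec n (\<lambda>i. vec_index x (\<alpha> i))"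
      have "?y \<in> solutions n a Q"
        unfolding \<alpha>(2) by (rule lab_sol[OF P \<alpha>(1) x(1)])
      moreover have "X = (\<Sum>i<n. vec_index ?y i *\<^sub>R Q ! i)"
        using sum_relabel[OF \<alpha>(1) len[OF P], of "\<lambda>i X. vec_index x i *\<^sub>R X"]
        by (simp add: x(2) \<alpha>(2))
      ultimately show ?thesis
        unfolding points[OF Q] by blast
    qed
    then show ?thesis
      using plane_line_subset_eq assms(3) P Q by blast
  qed
  ultimately show ?thesis
    using assms(3) unfolding central_line_def by blast
qed

lemma central_line_subset_affine_hull:
  assumes "n \<ge> 1" "central_line n F \<Psi>" "P \<in> F" "length P = n"
    and "collinear (set P) \<Longrightarrow> set P \<subseteq> \<Psi> P"
  shows "\<Psi> P \<subseteq> affine hull (set P)"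
proof (cases "collinear (set P)")
  case False
  have "aff_dim (set P) = int (DIM(point))"
    using False aff_dim_le_DIM[of "set P"] unfolding collinear_aff_dim by simp
  then have "affine hull (set P) = UNIV"
    using aff_dim_eq_full[of "set P"] by blast
  then show ?thesis
    by blast
next
  case True
  then have sub: "set P \<subseteq> \<Psi> P"
    by (rule assms(5))
  have line: "\<Psi> P \<in> plane_lines"
    using assms(2,3) unfolding central_line_def by blast
  obtain V where V: "V \<in> set P"
    using assms(1,4) by (cases P) auto
  have "\<exists>W\<in>set P. W \<noteq> V"
  proof (rule ccontr)
    assume "\<not> ?thesis"
    \<comment> \<open>Then a quarter turn about \<open>V\<close> fixes the polygon but moves the line.\<close>
    then have const: "\<forall>W\<in>set P. W = V"
      by blast
    obtain T where T: "similarity T" "T V = V"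
      "\<And>L. L \<in> plane_lines \<Longrightarrow> V \<in> L \<Longrightarrow> T ` L \<noteq> L"
      using quarter_turn[of V] by blast
    have "map T P = P"
      using const T(2) by (intro map_idI) simp
    then have "T ` \<Psi> P = \<Psi> P"
      using assms(2,3) T(1) unfolding central_line_def by metis
    then show False
      using T(3) line V sub by blast
  qed
  then obtain W where W: "W \<in> set P" "V \<noteq> W"
    by blast
  have "\<Psi> P = affine hull {V, W}"
    using plane_line_eq[OF line _ _ W(2)] V W(1) sub by blast
  also have "\<dots> \<subseteq> affine hull (set P)"
    using V W(1) by (intro hull_mono) blast
  finally show ?thesis .
qed

lemma central_line_imp_given_by_linear_systems:
  assumes "n \<ge> 2" "closed_family n F" "central_line n F \<Psi>"
    and "\<And>P. P \<in> F \<Longrightarrow> collinear (set P) \<Longrightarrow> set P \<subseteq> \<Psi> P"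
  shows "given_by_linear_systems n F \<Psi>"
proof -
  have len: "length P = n" if "P \<in> F" for P
    using assms(2) that unfolding closed_family_def polygons_def by blast
  define W where "W P = affine_weights n P (\<Psi> P)" for P
  define M where "M c = mat (n - 1) n (\<lambda>(i, j). if i = 0 then 1 else c i j)"
    for c :: "nat \<Rightarrow> nat \<Rightarrow> real"
  have "W P \<noteq> {} \<and> \<Psi> P = {\<Sum>i<n. vec_index x i *\<^sub>R P ! i | x. x \<in> W P} \<and>
      (\<exists>c. {x \<in> carrier_vec n. M c *\<^sub>v x = unit_vec (n - 1) 0} = W P \<and>
           vec_space.rank (n - 1) (M c) = n - 1)" if P: "P \<in> F" for P
  proof -
    have line: "\<Psi> P \<in> plane_lines"
      using assms(3) P unfolding central_line_def by blast
    have "\<Psi> P \<subseteq> affine hull (set P)"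
      using central_line_subset_affine_hull[OF _ assms(3) P len[OF P]] assms(1,4) P by simp
    then obtain p v where pv: "(\<Sum>i<n. p i) = 1" "(\<Sum>i<n. v i) = 0" "\<exists>k<n. v k \<noteq> 0"
      "W P = {Matrix.vec n (\<lambda>i. p i + t * v i) | t. True}"
      "\<Psi> P = {\<Sum>i<n. vec_index x i *\<^sub>R P ! i | x. x \<in> W P}"
      unfolding W_def by (rule affine_weights_line[OF len[OF P] line])
    obtain c where "{x \<in> carrier_vec n. M c *\<^sub>v x = unit_vec (n - 1) 0} = W P"
      "vec_space.rank (n - 1) (M c) = n - 1"
      unfolding M_def pv(4) by (rule line_as_solution_set[OF assms(1) pv(1-3)])
    moreover have "W P \<noteq> {}"
      unfolding pv(4) by blast
    ultimately show ?thesis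
      using pv(5) by blast
  qed
  note weights = this
  then have "\<forall>P\<in>F. \<exists>c. {x \<in> carrier_vec n. M c *\<^sub>v x = unit_vec (n - 1) 0} = W P \<and>
           vec_space.rank (n - 1) (M c) = n - 1"
    by blast
  then obtain C where C: "\<forall>P\<in>F. {x \<in> carrier_vec n. M (C P) *\<^sub>v x = unit_vec (n - 1) 0} = W P \<and>
           vec_space.rank (n - 1) (M (C P)) = n - 1"
    by (rule bchoice[THEN exE])
  define a where "a i j P = C P i j" for i j P
  have A: "coeff_matrix n a P = M (C P)" for P
    unfolding coeff_matrix_def M_def a_def ..
  have sol: "solutions n a P = W P" if "P \<in> F" for P
    using C that unfolding solutions_def A by blast
  show ?thesis
    unfolding given_by_linear_systems_def
  proof (intro exI[of _ a] ballI conjI allI impI)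
    fix P assume P: "P \<in> F"
    show "solutions n a P \<noteq> {}"
      using weights[OF P] sol[OF P] by simp
    show "vec_space.rank (n - 1) (coeff_matrix n a P) = n - 1"
      using C P unfolding A by blast
    show "\<Psi> P = {\<Sum>i<n. vec_index x i *\<^sub>R P ! i | x. x \<in> solutions n a P}"
      using weights[OF P] sol[OF P] by simp
  next
    fix P \<alpha> x assume P: "P \<in> F" and \<alpha>: "\<alpha> \<in> dihedral n" and x: "x \<in> solutions n a P"
    have lab: "differ_in_labelling n P (relabel \<alpha> P)"
      using \<alpha> unfolding differ_in_labelling_def by blast
    then have Q: "relabel \<alpha> P \<in> F"
      using assms(2) P unfolding closed_family_def by blast
    then have "\<Psi> (relabel \<alpha> P) = \<Psi> P"
      using assms(3) P lab unfolding central_line_def by metis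
    then show "Matrix.vec n (\<lambda>i. vec_index x (\<alpha> i)) \<in> solutions n a (relabel \<alpha> P)"
      using affine_weights_relabel[OF \<alpha> len[OF P]] x sol[OF P] sol[OF Q] by (simp add: W_def)
  next
    fix P T x assume P: "P \<in> F" and T: "similarity T" and x: "x \<in> solutions n a P"
    have TP: "map T P \<in> F"
      using assms(2) P T unfolding closed_family_def by blast
    have "\<Psi> (map T P) = T ` \<Psi> P"
      using assms(3) P T unfolding central_line_def by blast
    then show "x \<in> solutions n a (map T P)"
      using affine_weights_similarity[OF T len[OF P]] x sol[OF P] sol[OF TP] by (simp add: W_def)
  qed
qed

theorem theorem5p4:
  fixes n :: nat and F :: "polygon set" and \<Psi> :: "polygon \<Rightarrow> point set"
  assumes "n \<ge> 3"
    and "closed_family n F"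
    and "\<Psi> \<in> F \<rightarrow> plane_lines"
  shows "(Kimberling_central_line n F \<Psi> \<longrightarrow> central_line n F \<Psi>) \<and>
         (Kimberling_central_line n F \<Psi> \<longrightarrow> given_by_linear_systems n F \<Psi>) \<and>
         (given_by_linear_systems n F \<Psi> \<longrightarrow> central_line n F \<Psi>) \<and>
         ((\<forall>P\<in>F. collinear (set P) \<longrightarrow> set P \<subseteq> \<Psi> P) \<longrightarrow>
            central_line n F \<Psi> \<longrightarrow> given_by_linear_systems n F \<Psi>)"
proof (intro conjI impI)
  assume K: "Kimberling_central_line n F \<Psi>"
  show "central_line n F \<Psi>"
    using Kimberling_imp_central_line assms(2) K by blast
  then show "given_by_linear_systems n F \<Psi>"
    using central_line_imp_given_by_linear_systems[OF _ assms(2)] assms(1)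
      Kimberling_line_contains_collinear_polygon[OF K] by simp
next
  assume "given_by_linear_systems n F \<Psi>"
  then show "central_line n F \<Psi>"
    using given_by_linear_systems_imp_central_line[OF _ assms(2,3)] assms(1) by simp
next
  assume "\<forall>P\<in>F. collinear (set P) \<longrightarrow> set P \<subseteq> \<Psi> P" "central_line n F \<Psi>"
  then show "given_by_linear_systems n F \<Psi>"
    using central_line_imp_given_by_linear_systems[OF _ assms(2)] assms(1) by simp
qed

end
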